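(* Let $\mathbb{K}$ be an algebraically closed field of characteristic zero, let $S$ be a numerical semigroup, and let $A\subseteq\mathbb{K}[x]$ be the corresponding monomial subalgebra, i.e. the subalgebra spanned over $\mathbb{K}$ by the constants and the monomials $x^s$, $s\in S$. Then for every $f\in\mathbb{K}[x]$: $f\in A$ if and only if $f^{(i)}(0)=0$ for each positive integer $i$ that does not belong to $S$.
   Context: A numerical semigroup here means an additive semigroup consisting of positive integers (a subset of the positive integers closed under addition). Subalgebras of $\mathbb{K}[x]$ always contain all constants. $f^{(i)}$ is the $i$-th derivative. *)

theory Defs
  imports Complex_Main "HOL-Computational_Algebra.Polynomial"
begin

(* Neither finiteness of the complement nor gcd 1 is part of this notion; the empty set is allowed. *)
definition numerical_semigroup :: "nat set \<Rightarrow> bool" where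
  "numerical_semigroup S \<longleftrightarrow> (\<forall>s\<in>S. 0 < s) \<and> (\<forall>s\<in>S. \<forall>t\<in>S. s + t \<in> S)"

interpretation poly_module: module "smult :: 'a::comm_ring_1 \<Rightarrow> 'a poly \<Rightarrow> 'a poly"
  by unfold_locales (simp_all add: smult_add_right smult_add_left)

definition monomial_subalgebra :: "nat set \<Rightarrow> 'a::field poly set" where
  "monomial_subalgebra S = poly_module.span (range (\<lambda>c. [:c:]) \<union> (\<lambda>s. monom 1 s) ` S)"

lemma const_in_monomial_subalgebra: "[:c:] \<in> monomial_subalgebra S"
  unfolding monomial_subalgebra_def by (intro poly_module.span_base) auto

lemma subspace_monomial_subalgebra: "poly_module.subspace (monomial_subalgebra S)"
  unfolding monomial_subalgebra_def by (rule poly_module.subspace_span)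

lemma mult_in_monomial_subalgebra:
  assumes S: "numerical_semigroup S"
    and f: "f \<in> monomial_subalgebra S" and g: "g \<in> monomial_subalgebra S"
  shows "f * g \<in> monomial_subalgebra S"
proof -
  let ?A = "monomial_subalgebra S :: 'a poly set"
  let ?B = "range (\<lambda>c::'a. [:c:]) \<union> (\<lambda>s. monom 1 s) ` S"
  have base: "b \<in> ?A" if "b \<in> ?B" for b
    using that unfolding monomial_subalgebra_def by (rule poly_module.span_base)
  have scale: "smult c b \<in> ?A" if "b \<in> ?A" for c b
    using that subspace_monomial_subalgebra poly_module.subspace_scale by blast
  have bb: "b * b' \<in> ?A" if b: "b \<in> ?B" and b': "b' \<in> ?B" for b b'
    using b
  proof
    assume "b \<in> range (\<lambda>c. [:c:])"
    then show ?thesis using scale[OF base[OF b']] by auto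
  next
    assume "b \<in> (\<lambda>s. monom 1 s) ` S"
    then obtain s where s: "s \<in> S" "b = monom 1 s" by auto
    from b' show ?thesis
    proof
      assume "b' \<in> range (\<lambda>c. [:c:])"
      then show ?thesis using scale[OF base[OF b]] by auto
    next
      assume "b' \<in> (\<lambda>s. monom 1 s) ` S"
      then obtain t where t: "t \<in> S" "b' = monom 1 t" by auto
      have "s + t \<in> S" using S s t unfolding numerical_semigroup_def by blast
      then show ?thesis using base[of "monom 1 (s + t)"] s t by (simp add: mult_monom)
    qed
  qed
  have bg: "b * g \<in> ?A" if b: "b \<in> ?B" for b
    using g[unfolded monomial_subalgebra_def]
  proof (rule poly_module.span_induct)
    show "poly_module.subspace {g. b * g \<in> ?A}"
      using subspace_monomial_subalgebra[of S, where 'a='a]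
      by (simp add: poly_module.subspace_def distrib_left)
  qed (use bb[OF b] in auto)
  show ?thesis using f[unfolded monomial_subalgebra_def]
  proof (rule poly_module.span_induct)
    show "poly_module.subspace {f. f * g \<in> ?A}"
      using subspace_monomial_subalgebra[of S, where 'a='a]
      by (simp add: poly_module.subspace_def distrib_right)
  qed (use bg in auto)
qed

end

theory Submission
  imports Defs
begin

text \<open>
  Both sides of the equivalence are conditions on the coefficients of \<open>f\<close>. The span of the
  constants and of the monomials with exponent in \<open>S\<close> consists of the polynomials supported in
  \<open>S \<union> {0}\<close> (\<open>monomial_subalgebra_iff_coeff\<close>). By Taylor's formula at the origin, the \<open>i\<close>-th
  derivative there is \<open>i!\<close> times the coefficient of \<open>x\<^sup>i\<close> (\<open>higher_pderiv_at_0\<close>), and \<open>i!\<close> is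
  invertible in characteristic zero, so the vanishing of the one is that of the other.
\<close>

lemma higher_pderiv_at_0:
  fixes f :: "'a::{idom, ring_char_0} poly"
  shows "poly ((pderiv ^^ i) f) 0 = fact i * coeff f i"
  by (simp add: poly_0_coeff_0 coeff_higher_pderiv flip: pochhammer_fact)

text \<open>
  Vanishing of given coefficients is a linear condition, so it need only be checked on the
  generators; conversely a polynomial is the sum of its terms, and the hypothesis
  makes each of them a scalar multiple of a generator or zero.
\<close>

lemma monomial_subalgebra_iff_coeff:
  fixes f :: "'a::field poly"
  shows "f \<in> monomial_subalgebra S \<longleftrightarrow> (\<forall>i. 0 < i \<and> i \<notin> S \<longrightarrow> coeff f i = 0)"
proof
  assume "f \<in> monomial_subalgebra S"
  then show "\<forall>i. 0 < i \<and> i \<notin> S \<longrightarrow> coeff f i = 0"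
    unfolding monomial_subalgebra_def
  proof (rule poly_module.span_induct)
    show "poly_module.subspace {f :: 'a poly. \<forall>i. 0 < i \<and> i \<notin> S \<longrightarrow> coeff f i = 0}"
      by (simp add: poly_module.subspace_def)
  qed (auto simp: coeff_pCons split: nat.split)
next
  assume vanish: "\<forall>i. 0 < i \<and> i \<notin> S \<longrightarrow> coeff f i = 0"
  have "monom (coeff f i) i \<in> monomial_subalgebra S" for i
  proof -
    consider "i = 0" | "i \<in> S" | "coeff f i = 0"
      using vanish by blast
    then show ?thesis
    proof cases
      case 1
      then show ?thesis
        using const_in_monomial_subalgebra by (simp add: monom_0)
    next
      case 2
      then have "monom 1 i \<in> (monomial_subalgebra S :: 'a poly set)"
        unfolding monomial_subalgebra_def by (intro poly_module.span_base) auto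
      then have "smult (coeff f i) (monom 1 i) \<in> monomial_subalgebra S"
        using subspace_monomial_subalgebra by (rule poly_module.subspace_scale[rotated])
      then show ?thesis
        by (simp add: smult_monom)
    next
      case 3
      then show ?thesis
        using poly_module.subspace_0[OF subspace_monomial_subalgebra] by simp
    qed
  qed
  then have "(\<Sum>i\<le>degree f. monom (coeff f i) i) \<in> monomial_subalgebra S"
    using subspace_monomial_subalgebra by (intro poly_module.subspace_sum)
  then show "f \<in> monomial_subalgebra S"
    by (simp add: poly_as_sum_of_monoms)
qed

theorem theorem1:
  fixes S :: "nat set" and f :: "'a::{alg_closed_field, field_char_0} poly"
  assumes "numerical_semigroup S"
  shows "f \<in> monomial_subalgebra S \<longleftrightarrow>
    (\<forall>i::nat. 0 < i \<and> i \<notin> S \<longrightarrow> poly ((pderiv ^^ i) f) 0 = 0)"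
  by (simp add: monomial_subalgebra_iff_coeff higher_pderiv_at_0)

end
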